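(* Let $n\ge 1$, let $p_1,\dots,p_n>0$ with $\sum_{i=1}^n p_i=1$, let $\alpha\in[0,1]$, and let $m_1\le m_2\le\dots\le m_n$ be real numbers (the minimum achievable average travel times in the $n$ demand scenarios, indexed in ascending order). For $T=(T_1,\dots,T_n)\in\mathbb{R}^n$ put $$\mathbb{E}[T]=\sum_{i=1}^n p_iT_i,\qquad \mathrm{Std}[T]=\Big(\sum_{i=1}^n p_i\,(T_i-\mathbb{E}[T])^2\Big)^{1/2},\qquad J(T)=\alpha\,\mathbb{E}[T]+(1-\alpha)\,\mathrm{Std}[T].$$ Let $T=(T_1,\dots,T_n)$ be an optimal solution of the problem of minimizing $J(T)$ subject to $T_i\ge m_i$ for all $i=1,\dots,n$. Then $T$ has a threshold structure: there exist an index $j^*\in\{0,1,\dots,n\}$ and a constant $\mathcal{T}^*\in\mathbb{R}$ such that 1. for all $i\le j^*$: $T_i=\mathcal{T}^*$ and $\mathcal{T}^*>m_i$; 2. for all $i>j^*$: $T_i=m_i$ (the constraint is binding). Moreover, when $\alpha<1$, the threshold value satisfies $$\mathcal{T}^*=\mathbb{E}[T]-\frac{\alpha}{1-\alpha}\,\mathrm{Std}[T].$$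
   Context: The stochastic parameter (daily peak demand) takes finitely many values $q_p^1,\dots,q_p^n$ with probabilities $p_i=p(q_p^i)>0$. $T_i=\mathcal{T}_{\mathrm{avg}}(q_p^i)$ is the average travel time chosen by the controller in scenario $i$, and $m_i$ is the minimum achievable average travel time in scenario $i$, a given constant. An index $j^*=0$ means that condition 1 is vacuous. *)

theory Defs
  imports Complex_Main
begin

text \<open>
  Scenarios are indexed by \<open>{1..n}\<close>. Vectors in \<open>\<real>\<^sup>n\<close> are functions \<open>nat \<Rightarrow> real\<close> of which only
  the values on \<open>{1..n}\<close> matter; this keeps the order of the indices available.
\<close>

definition mean :: "nat \<Rightarrow> (nat \<Rightarrow> real) \<Rightarrow> (nat \<Rightarrow> real) \<Rightarrow> real" where
  "mean n p T = (\<Sum>i=1..n. p i * T i)"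

definition std_dev :: "nat \<Rightarrow> (nat \<Rightarrow> real) \<Rightarrow> (nat \<Rightarrow> real) \<Rightarrow> real" where
  "std_dev n p T = sqrt (\<Sum>i=1..n. p i * (T i - mean n p T)\<^sup>2)"

definition objective :: "nat \<Rightarrow> (nat \<Rightarrow> real) \<Rightarrow> real \<Rightarrow> (nat \<Rightarrow> real) \<Rightarrow> real" where
  "objective n p \<alpha> T = \<alpha> * mean n p T + (1 - \<alpha>) * std_dev n p T"

definition feasible :: "nat \<Rightarrow> (nat \<Rightarrow> real) \<Rightarrow> (nat \<Rightarrow> real) \<Rightarrow> bool" where
  "feasible n m T \<longleftrightarrow> (\<forall>i\<in>{1..n}. m i \<le> T i)"

end

theory Submission
  imports Defs
begin

text \<open>
  Changing the single value \<open>T\<^sub>i\<close> by \<open>h\<close> turns the objective into a function of \<open>h\<close> whose derivative at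
  \<open>0\<close>, when the standard deviation is positive, is \<open>p\<^sub>i (\<alpha> + (1 - \<alpha>) (T\<^sub>i - \<E>[T]) / Std[T])\<close>. Its sign
  is that of \<open>T\<^sub>i - \<tau>\<close> for \<open>\<tau> = \<E>[T] - \<alpha> / (1 - \<alpha>) Std[T]\<close>. Raising \<open>T\<^sub>i\<close> is always feasible, so
  \<open>T\<^sub>i \<ge> \<tau>\<close> at an optimum; lowering it is feasible where the constraint is slack, so there \<open>T\<^sub>i = \<tau>\<close>.
  If \<open>T\<^sub>i > m\<^sub>i\<close> and \<open>k \<le> i\<close>, then \<open>m\<^sub>k \<le> m\<^sub>i < \<tau> \<le> T\<^sub>k\<close>, so the slack indices form an initial segment.
\<close>

lemma mean_fun_upd:
  assumes "i \<in> {1..n}"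
  shows "mean n p (T(i := T i + h)) = mean n p T + p i * h"
proof -
  have "mean n p (T(i := T i + h)) = (\<Sum>k=1..n. p k * T k + (if k = i then p i * h else 0))"
    unfolding mean_def by (rule sum.cong) (auto simp: algebra_simps)
  then show ?thesis
    using assms by (simp add: sum.distrib mean_def)
qed

lemma variance_eq:
  assumes "(\<Sum>i=1..n. p i) = (1 :: real)"
  shows "(\<Sum>i=1..n. p i * (T i - mean n p T)\<^sup>2) = mean n p (\<lambda>i. (T i)\<^sup>2) - (mean n p T)\<^sup>2"
proof -
  define E where "E = mean n p T"
  have "(\<Sum>i=1..n. p i * (T i - E)\<^sup>2) = (\<Sum>i=1..n. p i * (T i)\<^sup>2 - 2 * E * (p i * T i) + E\<^sup>2 * p i)"
    by (rule sum.cong) (auto simp: power2_eq_square algebra_simps)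
  also have "\<dots> = mean n p (\<lambda>i. (T i)\<^sup>2) - 2 * E * E + E\<^sup>2 * (\<Sum>i=1..n. p i)"
    by (simp add: sum.distrib sum_subtractf sum_distrib_left [symmetric] mean_def E_def)
  finally show ?thesis
    using assms by (simp add: E_def power2_eq_square)
qed

text \<open>By \<open>variance_eq\<close> the variance is the mean of the squares minus the square
  of the mean, and \<open>mean_fun_upd\<close> applies to both means. The result is a quadratic
  polynomial in \<open>h\<close>, ready to be differentiated.\<close>

lemma variance_fun_upd:
  assumes "(\<Sum>i=1..n. p i) = (1 :: real)" "i \<in> {1..n}"
  shows "(\<Sum>k=1..n. p k * ((T(i := T i + h)) k - mean n p (T(i := T i + h)))\<^sup>2)
    = (\<Sum>k=1..n. p k * (T k - mean n p T)\<^sup>2) + 2 * p i * (T i - mean n p T) * h + (p i - (p i)\<^sup>2) * h\<^sup>2"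
proof -
  have "(\<lambda>k. ((T(i := T i + h)) k)\<^sup>2)
      = (\<lambda>k. (T k)\<^sup>2)(i := (\<lambda>k. (T k)\<^sup>2) i + (2 * T i * h + h\<^sup>2))"
    by (auto simp: power2_sum)
  then have "mean n p (\<lambda>k. ((T(i := T i + h)) k)\<^sup>2)
      = mean n p (\<lambda>k. (T k)\<^sup>2) + p i * (2 * T i * h + h\<^sup>2)"
    using mean_fun_upd [OF assms(2), of p "\<lambda>k. (T k)\<^sup>2"] by simp
  then show ?thesis
    unfolding variance_eq [OF assms(1)] by (simp only: mean_fun_upd [OF assms(2)])
      (simp add: power2_eq_square algebra_simps)
qed

lemma DERIV_objective_fun_upd:
  assumes "(\<Sum>i=1..n. p i) = (1 :: real)" "i \<in> {1..n}" "std_dev n p T > 0"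
  shows "((\<lambda>h. objective n p \<alpha> (T(i := T i + h))) has_real_derivative
    p i * (\<alpha> + (1 - \<alpha>) * ((T i - mean n p T) / std_dev n p T))) (at 0)"
proof -
  define V where "V = (\<Sum>k=1..n. p k * (T k - mean n p T)\<^sup>2)"
  have sd: "std_dev n p T = sqrt V"
    by (simp add: std_dev_def V_def)
  then have V: "V > 0"
    using assms(3) by simp
  show ?thesis
    \<comment> \<open>\<open>std_dev_def\<close> is instantiated so that only the deviation of the
      updated vector unfolds. Since \<open>mean_fun_upd\<close> also rewrites the mean inside the
      variance, \<open>variance_fun_upd\<close> is brought into the matching form.\<close>
    unfolding objective_def std_dev_def [of n p "fun_upd _ _ _"] mean_fun_upd [OF assms(2)]
      variance_fun_upd [OF assms(1,2), unfolded mean_fun_upd [OF assms(2)]]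
    unfolding sd V_def [symmetric]
    using V by (auto intro!: derivative_eq_intros simp: field_simps)
qed

lemma arg_min_ge_threshold:
  assumes pos: "\<And>i. i \<in> {1..n} \<Longrightarrow> p i > 0" and sum: "(\<Sum>i=1..n. p i) = 1" and "\<alpha> < 1"
    and opt: "is_arg_min (objective n p \<alpha>) (feasible n m) T" and i: "i \<in> {1..n}"
  defines "\<tau> \<equiv> mean n p T - \<alpha> / (1 - \<alpha>) * std_dev n p T"
  shows "T i \<ge> \<tau>" and "T i > m i \<Longrightarrow> T i = \<tau>"
proof -
  let ?S = "std_dev n p T"
  let ?D = "p i * (\<alpha> + (1 - \<alpha>) * ((T i - mean n p T) / ?S))"
  have feas: "feasible n m T" and min: "\<And>U. feasible n m U \<Longrightarrow> objective n p \<alpha> T \<le> objective n p \<alpha> U"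
    using opt by (auto simp: is_arg_min_def not_less)
  have nonneg: "0 \<le> (\<Sum>k=1..n. p k * (T k - mean n p T)\<^sup>2)"
    using pos by (intro sum_nonneg) (simp add: less_imp_le)
  have "T i \<ge> \<tau> \<and> (T i > m i \<longrightarrow> T i = \<tau>)"
  proof (cases "?S = 0")
    \<comment> \<open>Here the objective may fail to be differentiable. But all summands of the
      variance vanish, so \<open>T i\<close> is the mean, which is \<open>\<tau>\<close> when the
      deviation is zero.\<close>
    case True
    then have "(\<Sum>k=1..n. p k * (T k - mean n p T)\<^sup>2) = 0"
      by (simp add: std_dev_def)
    moreover have "\<forall>k\<in>{1..n}. 0 \<le> p k * (T k - mean n p T)\<^sup>2"
      using pos by (simp add: less_imp_le)
    ultimately have "p i * (T i - mean n p T)\<^sup>2 = 0"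
      using i by (metis (no_types, lifting) finite_atLeastAtMost sum_nonneg_eq_0_iff)
    then show ?thesis
      using pos [OF i] True by (simp add: \<tau>_def)
  next
    case False
    then have S: "?S > 0"
      using nonneg by (simp add: std_dev_def order_less_le)
    note deriv = DERIV_objective_fun_upd [OF sum i S]
    have D: "?D = p i * (1 - \<alpha>) / ?S * (T i - \<tau>)"
      using \<open>\<alpha> < 1\<close> S by (simp add: \<tau>_def field_simps)
    have c: "p i * (1 - \<alpha>) / ?S > 0"
      using pos [OF i] \<open>\<alpha> < 1\<close> S by simp
    have "T i \<ge> \<tau>"
    proof (rule ccontr)
      assume "\<not> T i \<ge> \<tau>"
      then have "?D < 0"
        unfolding D using c by (intro mult_pos_neg) auto
      from DERIV_neg_dec_right [OF deriv this] obtain d where d: "d > 0"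
        "\<And>h. 0 < h \<Longrightarrow> h < d \<Longrightarrow> objective n p \<alpha> (T(i := T i + h)) < objective n p \<alpha> T"
        by auto
      have "feasible n m (T(i := T i + d / 2))"
        using feas d(1) i by (auto simp: feasible_def intro: add_increasing2)
      with min d(2) [of "d / 2"] d(1) show False
        by fastforce
    qed
    moreover have "T i \<le> \<tau>" if "T i > m i"
    proof (rule ccontr)
      assume "\<not> T i \<le> \<tau>"
      then have "?D > 0"
        unfolding D using c by (intro mult_pos_pos) auto
      from DERIV_pos_inc_left [OF deriv this] obtain d where d: "d > 0"
        "\<And>h. 0 < h \<Longrightarrow> h < d \<Longrightarrow> objective n p \<alpha> (T(i := T i - h)) < objective n p \<alpha> T"
        by auto
      \<comment> \<open>\<open>d / 2\<close> stays inside the range of decrease;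
        \<open>T i - m i\<close> is the largest reduction that respects the constraint.\<close>
      define h where "h = min (d / 2) (T i - m i)"
      have h: "0 < h" "h < d" "h \<le> T i - m i"
        using d(1) that by (auto simp: h_def)
      have "feasible n m (T(i := T i - h))"
        using feas h by (auto simp: feasible_def)
      with min d(2) [OF h(1,2)] show False
        by fastforce
    qed
    ultimately show ?thesis
      by fastforce
  qed
  then show "T i \<ge> \<tau>" and "T i > m i \<Longrightarrow> T i = \<tau>"
    by auto
qed

text \<open>For weight 1 the threshold formula would divide by zero. The objective is then the mean
  alone, strictly increasing in each coordinate, so lowering a slack \<open>T i\<close> to
  \<open>m i\<close> would improve it.\<close>

lemma arg_min_mean_binding:
  assumes pos: "\<And>i. i \<in> {1..n} \<Longrightarrow> p i > 0"
    and opt: "is_arg_min (objective n p 1) (feasible n m) T" and i: "i \<in> {1..n}"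
  shows "T i = m i"
proof (rule ccontr)
  assume "T i \<noteq> m i"
  moreover have feas: "feasible n m T"
    using opt by (simp add: is_arg_min_def)
  ultimately have lt: "m i < T i"
    using i by (force simp: feasible_def)
  have "feasible n m (T(i := T i + (m i - T i)))"
    using feas by (simp add: feasible_def)
  moreover have "objective n p 1 (T(i := T i + (m i - T i))) < objective n p 1 T"
    unfolding objective_def mean_fun_upd [OF i] using pos [OF i] lt by (simp add: mult_pos_neg)
  ultimately show False
    using opt by (auto simp: is_arg_min_def)
qed

theorem proposition3p1:
  fixes n :: nat and p m T :: "nat \<Rightarrow> real" and \<alpha> :: real
  assumes "n \<ge> 1"
    and "\<And>i. i \<in> {1..n} \<Longrightarrow> p i > 0"
    and "(\<Sum>i=1..n. p i) = 1"
    and "0 \<le> \<alpha>" and "\<alpha> \<le> 1"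
    and "mono_on {1..n} m"
    and "is_arg_min (objective n p \<alpha>) (feasible n m) T"
  shows "\<exists>j\<in>{0..n}. \<exists>\<tau>::real.
           (\<forall>i\<in>{1..n}. i \<le> j \<longrightarrow> T i = \<tau> \<and> \<tau> > m i) \<and>
           (\<forall>i\<in>{1..n}. i > j \<longrightarrow> T i = m i) \<and>
           (\<alpha> < 1 \<longrightarrow> \<tau> = mean n p T - \<alpha> / (1 - \<alpha>) * std_dev n p T)"
proof (cases "\<alpha> < 1")
  case False
  then have "T i = m i" if "i \<in> {1..n}" for i
    using arg_min_mean_binding [OF assms(2)] assms(5,7) that by simp
  \<comment> \<open>No index is slack, so \<open>j = 0\<close> makes the first condition vacuous and
    any \<open>\<tau>\<close> will do.\<close>
  with False show ?thesis
    by (intro bexI [of _ 0]) auto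
next
  case True
  define \<tau> where "\<tau> = mean n p T - \<alpha> / (1 - \<alpha>) * std_dev n p T"
  define A where "A = {i \<in> {1..n}. T i > m i}"
  \<comment> \<open>Inserting 0 keeps the maximum meaningful when no constraint is slack, and then
    \<open>j = 0\<close>.\<close>
  define j where "j = Max (insert 0 A)"
  have thr: "\<tau> \<le> T i" "m i < T i \<Longrightarrow> T i = \<tau>" if "i \<in> {1..n}" for i
    using arg_min_ge_threshold [OF _ assms(3) True assms(7) that] assms(2) by (auto simp: \<tau>_def)
  have fin: "finite (insert 0 A)"
    by (simp add: A_def)
  have j: "j \<in> insert 0 A"
    unfolding j_def using fin by (intro Max_in) auto
  have "T i = \<tau> \<and> \<tau> > m i" if i: "i \<in> {1..n}" "i \<le> j" for i
  proof -
    \<comment> \<open>From \<open>1 \<le> i \<le> j\<close> it follows that \<open>j\<close> is not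
      the inserted 0, so it is a genuine slack index.\<close>
    have jn: "j \<in> {1..n}" "T j > m j"
      using i j by (auto simp: A_def)
    have "m i \<le> m j"
      using assms(6) i jn by (auto intro: mono_onD)
    also have "m j < \<tau>"
      using thr(2) [OF jn(1)] jn(2) by simp
    finally have "m i < \<tau>" .
    then show ?thesis
      using thr [OF i(1)] by auto
  qed
  moreover have "T i = m i" if i: "i \<in> {1..n}" "i > j" for i
  proof -
    have "i \<notin> A"
      using Max_ge [OF fin, of i] i(2) by (auto simp: j_def)
    then show ?thesis
      using i(1) assms(7) by (force simp: A_def is_arg_min_def feasible_def)
  qed
  moreover have "j \<in> {0..n}"
    using j by (auto simp: A_def)
  ultimately show ?thesis
    unfolding \<tau>_def by blast
qed

end
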